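(* Let $\alpha\in\mathbb{C}$, $\alpha\ne0$. Let $V(z)=-\log(1-2\alpha z+z^2)$ (with $V(0)=0$), with functional inverse $Z(v)=\alpha-\sqrt{\alpha^2+e^{-v}-1}$ near $v=0$ (the branch of the square root equal to $\alpha$ at $v=0$). Define polynomials $p_n$ and $q_n$ by $$e^{xZ(v)}=\sum_{n\ge0}\frac{v^n}{n!}\,p_n(x),\qquad e^{yV(z)}=(1-2\alpha z+z^2)^{-y}=\sum_{n\ge0}\frac{z^n}{n!}\,q_n(y).$$ Then for all $n\ge0$, $$p_n(x)=\sum_{k} S(n,k)\,(-1)^{n-k}\,(2\alpha^2)^{-k}\,p_k^{\rm Bessel}(\alpha x)$$ and $$q_n(x)=n!\,C_n^{(x)}(\alpha),$$ where $S(n,k)$ are the Stirling numbers of the second kind, $p_k^{\rm Bessel}$ are the Bessel polynomials $p_0^{\rm Bessel}=1$, $p_k^{\rm Bessel}(x)=x\theta_{k-1}(x)$ for $k\ge1$, and $C_n^{(x)}(\alpha)$ is the Gegenbauer polynomial in the variable $\alpha$ with parameter $x$.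
   Context: The reverse Bessel polynomials are $\theta_n(x)=\sum_{k=0}^n\frac{(n+k)!}{(n-k)!\,k!}\frac{x^{n-k}}{2^k}$. The Gegenbauer polynomials are $C_n^{(\lambda)}(\alpha)=\sum_{l=0}^{\lfloor n/2\rfloor}\frac{(-1)^l(\lambda)_{n-l}}{l!\,(n-2l)!}(2\alpha)^{n-2l}$, where $(\lambda)_m=\lambda(\lambda+1)\cdots(\lambda+m-1)$. The two generating function identities are expansions valid for small $v$ and $z$ respectively (equivalently, as formal power series). *)

theory Defs
  imports
    "HOL-Analysis.Analysis"
    "HOL-Computational_Algebra.Polynomial"
    "HOL-Combinatorics.Stirling"
begin

definition reverse_bessel :: "nat \<Rightarrow> complex \<Rightarrow> complex" where
  "reverse_bessel n x =
     (\<Sum>k\<le>n. fact (n + k) / (fact (n - k) * fact k) * (x ^ (n - k) / 2 ^ k))"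

definition bessel_poly :: "nat \<Rightarrow> complex \<Rightarrow> complex" where
  "bessel_poly k x = (if k = 0 then 1 else x * reverse_bessel (k - 1) x)"

text \<open>The Gegenbauer polynomial \<open>C_n^(lam)(a)\<close>; \<open>pochhammer\<close> is the rising factorial.\<close>

definition gegenbauer :: "nat \<Rightarrow> complex \<Rightarrow> complex \<Rightarrow> complex" where
  "gegenbauer n lam a =
     (\<Sum>l\<le>n div 2. (- 1) ^ l * pochhammer lam (n - l) / (fact l * fact (n - 2 * l))
        * (2 * a) ^ (n - 2 * l))"

text \<open>The branch of the square root near \<open>a\<^sup>2\<close> that takes the value \<open>a\<close> at \<open>a\<^sup>2\<close>.  The principal
  root \<open>csqrt\<close> is only applied near \<open>1\<close>, away from its branch cut, so the sign is right for
  every \<open>a \<noteq> 0\<close>.\<close>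

definition sqrt_branch :: "complex \<Rightarrow> complex \<Rightarrow> complex" where
  "sqrt_branch a w = a * csqrt (w / a\<^sup>2)"

lemma sqrt_branch_square: "a \<noteq> 0 \<Longrightarrow> (sqrt_branch a w)\<^sup>2 = w"
  by (simp add: sqrt_branch_def power_mult_distrib)

lemma sqrt_branch_at_square: "a \<noteq> 0 \<Longrightarrow> sqrt_branch a (a\<^sup>2) = a"
  by (simp add: sqrt_branch_def)

lemma isCont_sqrt_branch:
  assumes "a \<noteq> 0"
  shows "isCont (sqrt_branch a) (a\<^sup>2)"
proof -
  have "isCont csqrt (a\<^sup>2 / a\<^sup>2)"
    using assms by (intro continuous_at_csqrt) simp
  moreover have "isCont (\<lambda>w. w / a\<^sup>2) (a\<^sup>2)"
    using assms by (intro isCont_divide) simp_all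
  ultimately have "isCont (\<lambda>w. csqrt (w / a\<^sup>2)) (a\<^sup>2)"
    by (rule isCont_o2[rotated])
  then have "isCont (\<lambda>w. a * csqrt (w / a\<^sup>2)) (a\<^sup>2)"
    by (intro isCont_mult continuous_const)
  moreover have "sqrt_branch a = (\<lambda>w. a * csqrt (w / a\<^sup>2))"
    by (simp add: fun_eq_iff sqrt_branch_def)
  ultimately show ?thesis by simp
qed

text \<open>The principal logarithm is the branch with \<open>V(0) = 0\<close>; \<open>Z_inv\<close> is the local inverse of
  \<open>V_log\<close> at \<open>0\<close>.\<close>

definition V_log :: "complex \<Rightarrow> complex \<Rightarrow> complex" where
  "V_log a z = - Ln (1 - 2 * a * z + z\<^sup>2)"

definition Z_inv :: "complex \<Rightarrow> complex \<Rightarrow> complex" where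
  "Z_inv a v = a - sqrt_branch a (a\<^sup>2 + exp (- v) - 1)"

text \<open>The polynomials \<open>p n\<close> have the exponential generating function \<open>exp (x F(t))\<close>, the expansion
  being valid for \<open>t\<close> close to \<open>0\<close>.\<close>

definition exp_generated :: "(complex \<Rightarrow> complex) \<Rightarrow> (nat \<Rightarrow> complex poly) \<Rightarrow> bool" where
  "exp_generated F p \<longleftrightarrow>
     (\<forall>x. \<forall>\<^sub>F t in nhds 0. (\<lambda>n. t ^ n / fact n * poly (p n) x) sums exp (x * F t))"

end

theory Submission
  imports Defs "HOL-Complex_Analysis.Laurent_Convergence"
begin

text \<open>Both formulas compare Taylor coefficients at 0. For each fixed x, an expansion of
  \<open>exp (x * F t)\<close> is unique, so \<open>fact n\<close> times its coefficients are the
  only possible values of \<open>poly (p n) x\<close>; once they are seen to depend polynomially on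
  x, existence and uniqueness of the family follow (\<open>exp_generated_unique\<close>).

  For the first family, Z(v) = \<alpha> (1 - sqrt (1 - 2u)) with u = (1 - e^(-v)) / (2 \<alpha>^2).
  The function exp (y (1 - sqrt (1 - 2u))) solves a linear ODE of second order whose coefficient
  recurrence is that of the Bessel polynomials, so it is their exponential generating function
  (\<open>has_fps_expansion_bessel\<close>). Powers of e^(-v) - 1 generate the Stirling numbers
  (\<open>fps_exp_minus_1_power_nth\<close>), and composing the two series gives the stated sum
  (\<open>has_fps_expansion_exp_Z_inv\<close>).

  For the second family, the binomial series of (1 - w)^(-y) at w = z (2 \<alpha> - z), with each
  power of w expanded again, is the series of Gegenbauer polynomials
  (\<open>has_fps_expansion_exp_V_log\<close>).\<close>

section \<open>Generating functions and uniqueness of coefficients\<close>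

lemma exp_generated_iff:
  assumes "\<And>x. (\<lambda>t. exp (x * F t)) has_fps_expansion A x"
  shows "exp_generated F p \<longleftrightarrow> (\<forall>n x. poly (p n) x = fact n * fps_nth (A x) n)"
proof
  assume gen: "exp_generated F p"
  show "\<forall>n x. poly (p n) x = fact n * fps_nth (A x) n"
  proof (intro allI)
    fix n x
    define B where "B = Abs_fps (\<lambda>n. poly (p n) x / fact n)"
    have "(\<lambda>t. exp (x * F t)) has_fps_expansion B"
      using gen by (intro has_fps_expansionI) (simp add: exp_generated_def B_def mult_ac)
    then have "A x = B"
      using assms fps_expansion_unique_complex by blast
    then show "poly (p n) x = fact n * fps_nth (A x) n"
      by (simp add: B_def)
  qed
next
  assume coeffs: "\<forall>n x. poly (p n) x = fact n * fps_nth (A x) n"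
  show "exp_generated F p"
    unfolding exp_generated_def
  proof
    fix x
    have "\<forall>\<^sub>F t in nhds 0. eval_fps (A x) t = exp (x * F t)"
      using assms[of x] by (simp add: has_fps_expansion_def)
    \<comment> \<open>A value of \<open>eval_fps\<close> alone does not imply convergence of the
      series; lying inside the disc of convergence does.\<close>
    moreover have "\<forall>\<^sub>F t in nhds 0. t \<in> eball 0 (fps_conv_radius (A x))"
      using assms[of x]
      by (intro eventually_nhds_in_open) (auto simp: has_fps_expansion_def zero_ereal_def)
    ultimately show "\<forall>\<^sub>F t in nhds 0. (\<lambda>n. t ^ n / fact n * poly (p n) x) sums exp (x * F t)"
    proof eventually_elim
      case (elim t)
      then have "(\<lambda>n. fps_nth (A x) n * t ^ n) sums exp (x * F t)"
        using sums_eval_fps[of t "A x"] by simp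
      then show ?case
        using coeffs by (simp add: mult_ac)
    qed
  qed
qed

text \<open>The coefficients \<open>c n x\<close> are a priori mere functions of \<open>x\<close>,
  whence the third assumption. Uniqueness holds because a complex polynomial is determined by its
  values.\<close>

lemma exp_generated_unique:
  assumes "\<And>x. (\<lambda>t. exp (x * F t)) has_fps_expansion A x"
    and "\<And>n x. c n x = fact n * fps_nth (A x) n"
    and poly: "\<And>n. \<exists>r. \<forall>x. poly r x = c n x"
  shows "\<exists>!p. exp_generated F p"
    and "exp_generated F p \<Longrightarrow> poly (p n) x = c n x"
proof -
  have iff: "exp_generated F p \<longleftrightarrow> (\<forall>n x. poly (p n) x = c n x)" for p
    using exp_generated_iff[OF assms(1)] assms(2) by simp
  then show "exp_generated F p \<Longrightarrow> poly (p n) x = c n x"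
    by blast
  obtain p where "\<forall>n x. poly (p n) x = c n x"
    using poly by metis
  moreover have "q = p" if "\<forall>n x. poly (q n) x = c n x" for q
    using that calculation by (intro ext) (simp add: poly_eq_poly_eq_iff[symmetric] fun_eq_iff)
  ultimately show "\<exists>!p. exp_generated F p"
    unfolding iff by blast
qed

section \<open>Stirling numbers as coefficients of powers of an exponential\<close>

text \<open>The series E = e^(ct) - 1 satisfies E' = c (E + 1), so the derivative of E^(j+1) is
  (j+1) c (E^(j+1) + E^j). On coefficients this is the recurrence S(n+1,j+1) = (j+1) S(n,j+1) +
  S(n,j).\<close>

lemma fps_exp_minus_1_power_nth:
  "fps_nth ((fps_exp c - 1) ^ k) n = c ^ n * fact k * of_nat (Stirling n k) / fact n"
  for c :: "'a :: field_char_0"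
proof (induction n arbitrary: k)
  case 0
  show ?case by (cases k) simp_all
next
  case (Suc n)
  show ?case
  proof (cases k)
    case 0
    then show ?thesis by simp
  next
    case (Suc j)
    let ?E = "fps_exp c - 1 :: 'a fps"
    have "fps_deriv (?E ^ Suc j) = of_nat (Suc j) * (fps_const c * (?E + 1)) * ?E ^ j"
      by (subst fps_deriv_power') simp
    also have "\<dots> = fps_const (of_nat (Suc j) * c) * (?E ^ Suc j + ?E ^ j)"
      by (simp add: fps_of_nat[symmetric] algebra_simps del: of_nat_Suc flip: fps_const_mult)
    finally have "fps_nth (fps_deriv (?E ^ Suc j)) n
        = of_nat (Suc j) * c * (fps_nth (?E ^ Suc j) n + fps_nth (?E ^ j) n)"
      by (simp del: power_Suc of_nat_Suc)
    then have "of_nat (Suc n) * fps_nth (?E ^ Suc j) (Suc n)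
        = of_nat (Suc j) * c * (fps_nth (?E ^ Suc j) n + fps_nth (?E ^ j) n)"
      by (simp del: power_Suc of_nat_Suc)
    also have "\<dots> = of_nat (Suc n) *
        (c ^ Suc n * fact (Suc j) * of_nat (Stirling (Suc n) (Suc j)) / fact (Suc n))"
      unfolding Suc.IH by (simp add: divide_simps del: of_nat_Suc) (simp add: algebra_simps)
    finally show ?thesis
      unfolding Suc by (simp only: mult_cancel_left of_nat_eq_0_iff) simp
  qed
qed

section \<open>Bessel polynomials: recurrence and generating function\<close>

text \<open>The value 0 for \<open>k > n\<close> lets \<open>bessel_coeff_rec\<close> hold without
  side conditions and lets sums be padded to a common range.\<close>

definition bessel_coeff :: "nat \<Rightarrow> nat \<Rightarrow> complex" where
  "bessel_coeff n k = (if k \<le> n then fact (n + k) / (fact (n - k) * fact k * 2 ^ k) else 0)"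

lemma bessel_coeff_0 [simp]: "bessel_coeff n 0 = 1"
  by (simp add: bessel_coeff_def)

lemma bessel_coeff_add: "bessel_coeff (k + m) k = fact (2 * k + m) / (fact m * (fact k * 2 ^ k))"
  by (simp add: bessel_coeff_def mult_2 add_ac mult.assoc)

lemma fact_Suc_mult_power:
  "fact (Suc k) * 2 ^ Suc k = of_nat (2 * Suc k) * (fact k * (2 :: complex) ^ k)"
  by (simp add: algebra_simps)

lemma bessel_coeff_Suc_Suc:
  "of_nat (2 * Suc k) * bessel_coeff (Suc k + m) (Suc k)
     = of_nat ((2 * k + m + 2) * (2 * k + m + 1)) * bessel_coeff (k + m) k"
proof -
  have "2 * Suc k + m = Suc (Suc (2 * k + m))"
    by simp
  then have "fact (2 * Suc k + m)
      = (of_nat ((2 * k + m + 2) * (2 * k + m + 1)) * fact (2 * k + m) :: complex)"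
    by (simp add: algebra_simps)
  moreover have "of_nat (2 * Suc k) \<noteq> (0 :: complex)"
    unfolding of_nat_eq_0_iff by simp
  ultimately show ?thesis
    unfolding bessel_coeff_add fact_Suc_mult_power by (simp del: of_nat_mult of_nat_add of_nat_Suc)
qed

text \<open>For \<open>m\<close> equal to 0 or 1 the left side lies outside the triangle
  \<open>k \<le> n\<close>, and the factor \<open>m * (m - 1)\<close> vanishes as well.\<close>

lemma bessel_coeff_Suc_right:
  assumes "n + 1 = k + m"
  shows "of_nat (2 * Suc k) * bessel_coeff n (Suc k) = of_nat (m * (m - 1)) * bessel_coeff (k + m) k"
proof -
  consider "m = 0" | "m = 1" | d where "m = Suc (Suc d)"
    by (cases m rule: nat.exhaust; metis One_nat_def not0_implies_Suc)
  then show ?thesis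
  proof cases
    case 3
    then have n: "n = Suc k + d"
      using assms by simp
    have "fact m = (of_nat (m * (m - 1)) * fact d :: complex)"
      by (simp add: 3 algebra_simps)
    moreover have "2 * Suc k + d = 2 * k + m"
      by (simp add: 3)
    then have "fact (2 * Suc k + d) = (fact (2 * k + m) :: complex)"
      by (simp only:)
    moreover have "of_nat (2 * Suc k) \<noteq> (0 :: complex)" "of_nat (m * (m - 1)) \<noteq> (0 :: complex)"
      unfolding of_nat_eq_0_iff by (simp_all add: 3)
    ultimately show ?thesis
      unfolding n bessel_coeff_add fact_Suc_mult_power
      by (simp del: of_nat_mult of_nat_add of_nat_Suc fact_Suc mult_Suc_right)
  qed (use assms in \<open>simp_all add: bessel_coeff_def\<close>)
qed

text \<open>With n + 1 = k + m, multiplying by 2(k+1) turns every term into a multiple of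
  \<open>bessel_coeff (k + m) k\<close>. What remains is (2k+m+2)(2k+m+1) = m(m-1) +
  2(k+1)(2k+2m+1).\<close>

lemma bessel_coeff_rec:
  "bessel_coeff (n + 2) (Suc k) =
     bessel_coeff n (Suc k) + of_nat (2 * n + 3) * bessel_coeff (n + 1) k"
proof (cases "k \<le> n + 1")
  case True
  define c :: complex where "c = of_nat (2 * Suc k)"
  have "c \<noteq> 0"
    unfolding c_def of_nat_eq_0_iff by simp
  obtain m where m: "n + 1 = k + m"
    using True le_Suc_ex by blast
  then have n2: "n + 2 = Suc k + m" and n3: "2 * n + 3 = 2 * k + 2 * m + 1"
    by linarith+
  have "(2 * k + m + 2) * (2 * k + m + 1) = m * (m - 1) + 2 * Suc k * (2 * k + 2 * m + 1)"
    by (cases m) (simp_all add: algebra_simps)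
  then have "of_nat ((2 * k + m + 2) * (2 * k + m + 1)) =
      of_nat (m * (m - 1)) + c * of_nat (2 * k + 2 * m + 1)"
    by (simp only: c_def of_nat_add of_nat_mult)
  then have "c * bessel_coeff (n + 2) (Suc k)
      = c * (bessel_coeff n (Suc k) + of_nat (2 * n + 3) * bessel_coeff (n + 1) k)"
    unfolding n2 n3 c_def distrib_left bessel_coeff_Suc_Suc bessel_coeff_Suc_right[OF m]
    by (simp only: m mult.assoc[symmetric] distrib_right[of _ _ "bessel_coeff (k + m) k"])
  then show ?thesis
    using \<open>c \<noteq> 0\<close> by simp
next
  case False
  then show ?thesis
    by (simp add: bessel_coeff_def)
qed

lemma reverse_bessel_altdef: "reverse_bessel n x = (\<Sum>k\<le>n. bessel_coeff n k * x ^ (n - k))"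
  unfolding reverse_bessel_def by (intro sum.cong) (auto simp: bessel_coeff_def)

lemma reverse_bessel_rec:
  "reverse_bessel (n + 2) x = of_nat (2 * n + 3) * reverse_bessel (n + 1) x + x\<^sup>2 * reverse_bessel n x"
proof -
  \<comment> \<open>Two zero terms are appended so that the range agrees with that of
    \<open>reverse_bessel (n + 2) x\<close>.\<close>
  have square: "x\<^sup>2 * reverse_bessel n x = (\<Sum>k\<le>Suc (n + 1). bessel_coeff n k * x ^ (n + 2 - k))"
  proof -
    have "x\<^sup>2 * reverse_bessel n x = (\<Sum>k\<le>n. bessel_coeff n k * x ^ (n + 2 - k))"
      unfolding reverse_bessel_altdef sum_distrib_left
      by (intro sum.cong) (auto simp: Suc_diff_le power2_eq_square)
    also have "\<dots> = (\<Sum>k\<le>Suc (n + 1). bessel_coeff n k * x ^ (n + 2 - k))"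
      by (simp add: bessel_coeff_def)
    finally show ?thesis .
  qed
  have "reverse_bessel (n + 2) x
      = (\<Sum>k\<le>Suc (n + 1). bessel_coeff (n + 2) k * x ^ (n + 2 - k))"
    by (simp add: reverse_bessel_altdef)
  also have "\<dots> = x ^ (n + 2) + (\<Sum>k\<le>n + 1. bessel_coeff n (Suc k) * x ^ (n + 1 - k))
      + of_nat (2 * n + 3) * (\<Sum>k\<le>n + 1. bessel_coeff (n + 1) k * x ^ (n + 1 - k))"
    unfolding sum.atMost_Suc_shift bessel_coeff_rec sum_distrib_left
    by (simp add: sum.distrib ring_distribs mult.assoc del: sum.atMost_Suc)
  also have "x ^ (n + 2) + (\<Sum>k\<le>n + 1. bessel_coeff n (Suc k) * x ^ (n + 1 - k))
      = x\<^sup>2 * reverse_bessel n x"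
    unfolding square sum.atMost_Suc_shift by (simp del: sum.atMost_Suc)
  finally show ?thesis
    by (simp add: reverse_bessel_altdef)
qed

text \<open>This is \<open>reverse_bessel_rec\<close> shifted by one index; n = 0 is separate
  because \<open>bessel_poly 0\<close> is not x times a reverse Bessel polynomial.\<close>

lemma bessel_poly_rec:
  "bessel_poly (n + 2) x = of_nat (2 * n + 1) * bessel_poly (n + 1) x + x\<^sup>2 * bessel_poly n x"
proof (cases n)
  case 0
  then show ?thesis
    by (simp add: bessel_poly_def reverse_bessel_def power2_eq_square algebra_simps)
next
  case (Suc m)
  then show ?thesis
    using reverse_bessel_rec[of m x] by (simp add: bessel_poly_def algebra_simps)
qed

text \<open>With \<open>s = sqrt (1 - 2 u)\<close> and \<open>g = exp (x (1 - s))\<close> we have \<open>s g' = x g\<close>; differentiating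
  once more and multiplying by \<open>s\<close> removes the square root and gives
  \<open>(1 - 2 u) g'' = g' + x\<^sup>2 g\<close>, which is the recurrence for the Bessel polynomials.\<close>

lemma has_fps_expansion_bessel:
  "(\<lambda>u. exp (x * (1 - csqrt (1 - 2 * u)))) has_fps_expansion
     Abs_fps (\<lambda>n. bessel_poly n x / fact n)"
proof -
  define g where "g = (\<lambda>u. exp (x * (1 - csqrt (1 - 2 * u))))"
  define G where "G = fps_expansion g 0"
  have "g analytic_on {0}"
    unfolding g_def by (intro analytic_intros) auto
  then have g: "g has_fps_expansion G"
    unfolding G_def by (rule analytic_at_imp_has_fps_expansion_0)
  \<comment> \<open>The radius 1/2 keeps 1 - 2u in the open right half-plane, away from the branch
    cut and the zero of \<open>csqrt\<close>.\<close>
  define U :: "complex set" where "U = ball 0 (1 / 2)"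
  have U: "open U" "0 \<in> U" by (auto simp: U_def)
  have nonpos: "1 - 2 * u \<notin> \<real>\<^sub>\<le>\<^sub>0" if "u \<in> U" for u
    using that complex_Re_le_cmod[of u] by (auto simp: U_def complex_nonpos_Reals_iff)
  have nz: "csqrt (1 - 2 * u) \<noteq> 0" if "u \<in> U" for u
    using nonpos[OF that] by auto
  have s': "((\<lambda>u. csqrt (1 - 2 * u)) has_field_derivative - 1 / csqrt (1 - 2 * u)) (at u)"
    if "u \<in> U" for u
    using nonpos[OF that] nz[OF that]
    by (auto intro!: derivative_eq_intros)
  have g': "(g has_field_derivative x * g u / csqrt (1 - 2 * u)) (at u)" if "u \<in> U" for u
  proof -
    have "(g has_field_derivative g u * (x * (0 - - 1 / csqrt (1 - 2 * u)))) (at u)"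
      unfolding g_def by (intro DERIV_fun_exp DERIV_cmult DERIV_diff DERIV_const s' that)
    then show ?thesis by (simp add: mult_ac)
  qed
  have dg: "deriv g u = x * g u / csqrt (1 - 2 * u)" if "u \<in> U" for u
    using g'[OF that] by (rule DERIV_imp_deriv)
  have g'': "((\<lambda>u. x * g u / csqrt (1 - 2 * u)) has_field_derivative
      (x\<^sup>2 * g u + deriv g u) / (1 - 2 * u)) (at u)" if "u \<in> U" for u
  proof -
    let ?s = "csqrt (1 - 2 * u)"
    have "((\<lambda>u. x * g u / csqrt (1 - 2 * u)) has_field_derivative
       (x * (x * g u / ?s) * ?s - x * g u * (- 1 / ?s)) / (?s * ?s)) (at u)"
      using nz[OF that] by (intro DERIV_divide DERIV_cmult g' s' that) auto
    moreover have "?s * ?s = 1 - 2 * u"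
      by (simp flip: power2_eq_square)
    ultimately show ?thesis
      using nz[OF that] by (simp add: dg[OF that] power2_eq_square mult.assoc)
  qed
  have "deriv (deriv g) u = (x\<^sup>2 * g u + deriv g u) / (1 - 2 * u)" if "u \<in> U" for u
  proof -
    have "\<forall>\<^sub>F w in nhds u. deriv g w = x * g w / csqrt (1 - 2 * w)"
      using eventually_nhds_in_open[OF \<open>open U\<close> that] by eventually_elim (rule dg)
    then have "deriv (deriv g) u = deriv (\<lambda>w. x * g w / csqrt (1 - 2 * w)) u"
      by (intro deriv_cong_ev) auto
    then show ?thesis
      using DERIV_imp_deriv[OF g''[OF that]] by simp
  qed
  then have ode: "(1 - 2 * u) * deriv (deriv g) u = deriv g u + x\<^sup>2 * g u" if "u \<in> U" for u
    using that nz[OF that] by auto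
  have lhs: "(\<lambda>u. (1 - 2 * u) * deriv (deriv g) u) has_fps_expansion
      (1 - 2 * fps_X) * fps_deriv (fps_deriv G)"
    by (intro fps_expansion_intros g)
  have rhs: "(\<lambda>u. deriv g u + x\<^sup>2 * g u) has_fps_expansion
      fps_deriv G + fps_const (x\<^sup>2) * G"
    by (intro fps_expansion_intros g)
  have "\<forall>\<^sub>F u in nhds 0. (1 - 2 * u) * deriv (deriv g) u = deriv g u + x\<^sup>2 * g u"
    using eventually_nhds_in_open[OF U] by eventually_elim (rule ode)
  from iffD1[OF has_fps_expansion_cong[OF this refl] lhs] rhs
  have fps_ode: "(1 - 2 * fps_X) * fps_deriv (fps_deriv G)
      = fps_deriv G + fps_const (x\<^sup>2) * G"
    by (rule fps_expansion_unique_complex)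
  \<comment> \<open>The factor (2n+1)(n+1) collects 2n(n+1) from -2u g'' and n+1 from g'. Multiplied
    by \<open>fact n\<close>, this is \<open>bessel_poly_rec\<close> for the numbers
    \<open>fact n * fps_nth G n\<close>.\<close>
  have rec: "of_nat ((n + 1) * (n + 2)) * fps_nth G (n + 2)
      = of_nat ((2 * n + 1) * (n + 1)) * fps_nth G (n + 1) + x\<^sup>2 * fps_nth G n" for n
  proof -
    have "fps_nth ((1 - 2 * fps_X) * fps_deriv (fps_deriv G)) n
        = of_nat ((n + 1) * (n + 2)) * fps_nth G (n + 2)
          - 2 * of_nat (n * (n + 1)) * fps_nth G (n + 1)"
      by (cases n) (simp_all add: algebra_simps numeral_fps_const)
    then show ?thesis
      unfolding fps_ode by (simp add: algebra_simps)
  qed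
  have G_0: "fps_nth G 0 = 1"
    using fps_nth_fps_expansion[OF g, of 0] by (simp add: g_def)
  have G_1: "fps_nth G 1 = x"
    using fps_nth_fps_expansion[OF g, of 1] dg[OF U(2)] by (simp add: g_def)
  have "fps_nth G n = bessel_poly n x / fact n" for n
  proof (induction n rule: induct_nat_012)
    case 0
    show ?case by (simp add: G_0 bessel_poly_def)
  next
    case 1
    show ?case using G_1 by (simp add: bessel_poly_def reverse_bessel_def)
  next
    case (ge2 n)
    have "of_nat ((n + 1) * (n + 2)) * fps_nth G (n + 2)
      = of_nat ((2 * n + 1) * (n + 1)) * (bessel_poly (n + 1) x / fact (n + 1))
        + x\<^sup>2 * (bessel_poly n x / fact n)"
      using rec[of n] ge2 by simp
    also have "\<dots> = bessel_poly (n + 2) x / fact n"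
      unfolding bessel_poly_rec by (simp add: divide_simps del: of_nat_Suc) (simp add: algebra_simps)
    also have "\<dots> = of_nat ((n + 1) * (n + 2)) * (bessel_poly (n + 2) x / fact (n + 2))"
      by (simp add: divide_simps del: of_nat_Suc) (simp add: algebra_simps)
    finally show ?case
      by (simp only: mult_cancel_left of_nat_eq_0_iff) simp
  qed
  then have "G = Abs_fps (\<lambda>n. bessel_poly n x / fact n)"
    by (intro fps_ext) simp
  then show ?thesis
    using g by (simp add: g_def)
qed

section \<open>Expansion of the exponential of the inverse function\<close>

definition bessel_stirling :: "complex \<Rightarrow> nat \<Rightarrow> complex \<Rightarrow> complex" where
  "bessel_stirling \<alpha> n x =
     (\<Sum>k\<le>n. of_nat (Stirling n k) * (- 1) ^ (n - k) * inverse ((2 * \<alpha>\<^sup>2) ^ k)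
        * bessel_poly k (\<alpha> * x))"

text \<open>\<open>Z_inv \<alpha> v = \<alpha> (1 - sqrt (1 - 2 u))\<close> with \<open>u = (1 - exp (- v)) / (2 \<alpha>\<^sup>2)\<close>.\<close>

lemma has_fps_expansion_exp_Z_inv:
  assumes "\<alpha> \<noteq> 0"
  shows "(\<lambda>v. exp (x * Z_inv \<alpha> v)) has_fps_expansion Abs_fps (\<lambda>n. bessel_stirling \<alpha> n x / fact n)"
proof -
  define c where "c = - inverse (2 * \<alpha>\<^sup>2)"
  define B where "B = Abs_fps (\<lambda>n. bessel_poly n (\<alpha> * x) / fact n)"
  have "(\<lambda>v. c * (exp (- 1 * v) - 1)) has_fps_expansion fps_const c * (fps_exp (- 1) - 1)"
    by (intro fps_expansion_intros)
  then have "((\<lambda>u. exp (\<alpha> * x * (1 - csqrt (1 - 2 * u)))) \<circ> (\<lambda>v. c * (exp (- 1 * v) - 1)))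
      has_fps_expansion (B oo (fps_const c * (fps_exp (- 1) - 1)))"
    unfolding B_def by (intro has_fps_expansion_compose has_fps_expansion_bessel) simp_all
  moreover have "(\<lambda>u. exp (\<alpha> * x * (1 - csqrt (1 - 2 * u)))) \<circ> (\<lambda>v. c * (exp (- 1 * v) - 1))
      = (\<lambda>v. exp (x * Z_inv \<alpha> v))"
  proof
    fix v
    \<comment> \<open>This is exactly the argument that \<open>sqrt_branch\<close> passes to
      \<open>csqrt\<close>, so the two functions agree for every \<open>v\<close>, with no branch to
      compare.\<close>
    have "1 - 2 * (c * (exp (- 1 * v) - 1)) = (\<alpha>\<^sup>2 + exp (- v) - 1) / \<alpha>\<^sup>2"
      using assms by (simp add: c_def field_simps)
    then show "((\<lambda>u. exp (\<alpha> * x * (1 - csqrt (1 - 2 * u)))) \<circ> (\<lambda>v. c * (exp (- 1 * v) - 1))) v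
        = exp (x * Z_inv \<alpha> v)"
      by (simp add: Z_inv_def sqrt_branch_def algebra_simps)
  qed
  moreover have "B oo (fps_const c * (fps_exp (- 1) - 1))
      = Abs_fps (\<lambda>n. bessel_stirling \<alpha> n x / fact n)"
  proof (rule fps_ext)
    fix n
    have "fps_nth (B oo (fps_const c * (fps_exp (- 1) - 1))) n
        = (\<Sum>k\<le>n. bessel_poly k (\<alpha> * x) / fact k
            * (c ^ k * ((- 1) ^ n * fact k * of_nat (Stirling n k) / fact n)))"
      unfolding fps_compose_nth power_mult_distrib fps_const_power fps_mult_left_const_nth
        fps_exp_minus_1_power_nth
      by (simp add: B_def atLeast0AtMost)
    also have "\<dots> = (\<Sum>k\<le>n. of_nat (Stirling n k) * (- 1) ^ (n - k) * inverse ((2 * \<alpha>\<^sup>2) ^ k)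
        * bessel_poly k (\<alpha> * x) / fact n)"
    proof (intro sum.cong refl)
      fix k assume "k \<in> {..n}"
      \<comment> \<open>The sign (-1)^n comes from the exponent -v and (-1)^k from \<open>c\<close>;
        their product is (-1)^(n-k).\<close>
      then have "(- 1) ^ n = (- 1) ^ (n - k) * (- 1 :: complex) ^ k"
        by (simp flip: power_add)
      moreover have "c ^ k = (- 1) ^ k * inverse ((2 * \<alpha>\<^sup>2) ^ k)"
        unfolding c_def power_minus[of "inverse (2 * \<alpha>\<^sup>2)"] power_inverse ..
      moreover have "(- 1 :: complex) ^ k * (- 1) ^ k = 1"
        by (simp flip: power_mult_distrib)
      ultimately show "bessel_poly k (\<alpha> * x) / fact k
            * (c ^ k * ((- 1) ^ n * fact k * of_nat (Stirling n k) / fact n))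
          = of_nat (Stirling n k) * (- 1) ^ (n - k) * inverse ((2 * \<alpha>\<^sup>2) ^ k)
            * bessel_poly k (\<alpha> * x) / fact n"
        by simp
    qed
    also have "\<dots> = bessel_stirling \<alpha> n x / fact n"
      by (simp add: bessel_stirling_def sum_divide_distrib)
    finally show "fps_nth (B oo (fps_const c * (fps_exp (- 1) - 1))) n
        = fps_nth (Abs_fps (\<lambda>n. bessel_stirling \<alpha> n x / fact n)) n"
      by simp
  qed
  ultimately show ?thesis
    by simp
qed

section \<open>Gegenbauer expansion\<close>

lemma eventually_trinomial_nonzero: "\<forall>\<^sub>F z in nhds 0. 1 - 2 * \<alpha> * z + z\<^sup>2 \<noteq> 0"
  for \<alpha> :: complex
proof -
  have "((\<lambda>z. 1 - 2 * \<alpha> * z + z\<^sup>2) \<longlongrightarrow> 1 - 2 * \<alpha> * 0 + 0\<^sup>2) (nhds 0)"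
    by (intro tendsto_intros filterlim_ident)
  then show ?thesis
    by (rule tendsto_imp_eventually_ne) simp
qed

text \<open>A zero of the trinomial must be excluded: there \<open>powr\<close> is 0, while
  \<open>exp\<close> never vanishes.\<close>

lemma exp_V_log:
  assumes "1 - 2 * \<alpha> * z + z\<^sup>2 \<noteq> 0"
  shows "exp (y * V_log \<alpha> z) = (1 - 2 * \<alpha> * z + z\<^sup>2) powr (- y)"
  using assms by (simp add: V_log_def powr_def)

lemma linear_power_nth:
  "fps_nth ((fps_const a - fps_X) ^ m) l = of_nat (m choose l) * (- 1) ^ l * a ^ (m - l)"
  for a :: "'a :: comm_ring_1"
proof -
  have "(fps_const a - fps_X) ^ m = (\<Sum>k\<le>m. of_nat (m choose k) * (- fps_X) ^ k * fps_const a ^ (m - k))"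
    using binomial_ring[of "- fps_X" "fps_const a" m] by simp
  also have "\<dots> = (\<Sum>k\<le>m. fps_const (of_nat (m choose k) * (- 1) ^ k * a ^ (m - k)) * fps_X ^ k)"
    by (intro sum.cong refl, subst power_minus)
       (simp add: fps_of_nat[symmetric] mult_ac flip: fps_const_mult fps_const_power fps_const_neg)
  finally show ?thesis
    by (cases "l \<le> m") (simp_all add: fps_sum_nth mult_delta_right sum.delta' binomial_eq_0)
qed

text \<open>Binomial expansion of \<open>(1 - w) powr (- y)\<close> at \<open>w = z (2 \<alpha> - z)\<close>.\<close>

lemma has_fps_expansion_exp_V_log:
  "(\<lambda>z. exp (y * V_log \<alpha> z)) has_fps_expansion Abs_fps (\<lambda>n. gegenbauer n y \<alpha>)"
proof -
  \<comment> \<open>Factoring out \<open>fps_X\<close> reduces coefficient n of W^m to coefficient n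
    - m of (2 \<alpha> - X)^m, which \<open>linear_power_nth\<close> gives.\<close>
  define W :: "complex fps" where "W = - (fps_X * (fps_const (2 * \<alpha>) - fps_X))"
  have "(\<lambda>z. - (z * (2 * \<alpha> - z))) has_fps_expansion W"
    unfolding W_def by (intro fps_expansion_intros)
  then have comp: "((\<lambda>w. (1 + w) powr (- y)) \<circ> (\<lambda>z. - (z * (2 * \<alpha> - z)))) has_fps_expansion
      (fps_binomial (- y) oo W)"
    by (intro has_fps_expansion_compose has_fps_expansion_binomial_complex) (simp_all add: W_def)
  have ev: "\<forall>\<^sub>F z in nhds 0.
      ((\<lambda>w. (1 + w) powr (- y)) \<circ> (\<lambda>z. - (z * (2 * \<alpha> - z)))) z = exp (y * V_log \<alpha> z)"
    using eventually_trinomial_nonzero[of \<alpha>]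
    by eventually_elim (simp add: exp_V_log algebra_simps power2_eq_square)
  have coeffs: "fps_binomial (- y) oo W = Abs_fps (\<lambda>n. gegenbauer n y \<alpha>)"
  proof (rule fps_ext)
    fix n
    define h where "h = (\<lambda>l. (- 1) ^ l * pochhammer y (n - l)
      / (fact l * fact (n - 2 * l)) * (2 * \<alpha>) ^ (n - 2 * l))"
    \<comment> \<open>Here l counts the factors -X chosen among the n - l factors 2 \<alpha> - X,
      which is possible only for \<open>l \<le> n div 2\<close>. The signs (-1)^(n-l) from
      \<open>W\<close> and from the generalized binomial coefficient cancel.\<close>
    have summand: "((- y) gchoose (n - l)) * fps_nth (W ^ (n - l)) n = (if l \<le> n div 2 then h l else 0)"
      if "l \<le> n" for l
    proof -
      have "W ^ (n - l) = fps_const ((- 1) ^ (n - l)) *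
          (fps_X ^ (n - l) * (fps_const (2 * \<alpha>) - fps_X) ^ (n - l))"
        unfolding W_def by (subst power_minus)
          (simp add: power_mult_distrib flip: fps_const_power fps_const_neg)
      then have "fps_nth (W ^ (n - l)) n = (- 1) ^ (n - l) *
          (of_nat ((n - l) choose l) * (- 1) ^ l * (2 * \<alpha>) ^ (n - l - l))"
        using that by (simp only: fps_mult_left_const_nth fps_X_power_mult_nth linear_power_nth) auto
      moreover have "(- y) gchoose (n - l) = (- 1) ^ (n - l) * pochhammer y (n - l) / fact (n - l)"
        by (simp add: gbinomial_pochhammer)
      moreover have "(- 1 :: complex) ^ (n - l) * (- 1) ^ (n - l) = 1"
        by (simp flip: power_mult_distrib)
      ultimately have eq: "((- y) gchoose (n - l)) * fps_nth (W ^ (n - l)) n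
          = pochhammer y (n - l) / fact (n - l)
            * (of_nat ((n - l) choose l) * (- 1) ^ l * (2 * \<alpha>) ^ (n - l - l))"
        by simp
      show ?thesis
      proof (cases "l \<le> n div 2")
        case True
        then have "l \<le> n - l" "n - l - l = n - 2 * l" by auto
        then show ?thesis
          using True unfolding eq h_def by (simp add: binomial_fact)
      next
        case False
        then have "(n - l) choose l = 0" by (intro binomial_eq_0) auto
        then show ?thesis using False unfolding eq by simp
      qed
    qed
    have "fps_nth (fps_binomial (- y) oo W) n
        = (\<Sum>m\<le>n. ((- y) gchoose m) * fps_nth (W ^ m) n)"
      by (simp add: fps_compose_nth atLeast0AtMost)
    also have "\<dots> = (\<Sum>l\<le>n. ((- y) gchoose (n - l)) * fps_nth (W ^ (n - l)) n)"
      by (rule sum.reindex_bij_witness[of _ "\<lambda>l. n - l" "\<lambda>m. n - m"]) auto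
    also have "\<dots> = (\<Sum>l\<le>n. if l \<le> n div 2 then h l else 0)"
      by (intro sum.cong refl summand) simp
    also have "\<dots> = (\<Sum>l\<le>n div 2. h l)"
      by (intro sum.mono_neutral_cong_right) auto
    finally show "fps_nth (fps_binomial (- y) oo W) n
        = fps_nth (Abs_fps (\<lambda>n. gegenbauer n y \<alpha>)) n"
      by (simp add: h_def gegenbauer_def)
  qed
  show ?thesis
    using comp has_fps_expansion_cong[OF ev coeffs] by (rule iffD1[rotated])
qed

section \<open>Polynomial dependence on the argument\<close>

lemma poly_bessel_poly: "\<exists>r. \<forall>x. poly r x = bessel_poly k x"
proof (cases k)
  case 0
  then show ?thesis by (intro exI[of _ 1]) (simp add: bessel_poly_def)
next
  case (Suc m)
  define r where "r = monom 1 1 * (\<Sum>j\<le>m. monom (bessel_coeff m j) (m - j))"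
  have "poly r x = bessel_poly k x" for x
    by (simp add: r_def Suc bessel_poly_def reverse_bessel_altdef poly_sum poly_monom)
  then show ?thesis by blast
qed

lemma poly_bessel_stirling: "\<exists>r. \<forall>x. poly r x = bessel_stirling \<alpha> n x"
proof -
  obtain b where b: "\<And>k x. poly (b k) x = bessel_poly k x"
    using poly_bessel_poly by metis
  define r where "r = (\<Sum>k\<le>n. smult (of_nat (Stirling n k) * (- 1) ^ (n - k)
    * inverse ((2 * \<alpha>\<^sup>2) ^ k)) (pcompose (b k) [:0, \<alpha>:]))"
  have "poly r x = bessel_stirling \<alpha> n x" for x
    by (simp add: r_def bessel_stirling_def poly_sum poly_pcompose b mult.commute)
  then show ?thesis by blast
qed

lemma poly_gegenbauer: "\<exists>r. \<forall>x. poly r x = gegenbauer n x a"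
proof -
  \<comment> \<open>The indeterminate is the Gegenbauer parameter, not the variable
    \<open>a\<close>, so the rising factorial is formed in the polynomial ring at
    \<open>[:0, 1:]\<close>.\<close>
  define r where "r = (\<Sum>l\<le>n div 2. smult ((- 1) ^ l / (fact l * fact (n - 2 * l))
    * (2 * a) ^ (n - 2 * l)) (pochhammer [:0, 1:] (n - l)))"
  have "poly r x = gegenbauer n x a" for x
    by (simp add: r_def gegenbauer_def poly_sum pochhammer_prod poly_prod mult_ac)
  then show ?thesis by blast
qed

section \<open>The two functions as local inverses, and the conclusion\<close>

text \<open>The radicand becomes (\<alpha> - z)^2. Near 0 the quotient 1 - z/\<alpha> has positive
  real part, so it is the principal root of its own square.\<close>

lemma Z_inv_V_log:
  assumes "\<alpha> \<noteq> 0"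
  shows "\<forall>\<^sub>F z in nhds 0. Z_inv \<alpha> (V_log \<alpha> z) = z"
proof -
  have "((\<lambda>z. Re (1 - z / \<alpha>)) \<longlongrightarrow> Re (1 - 0 / \<alpha>)) (nhds 0)"
    by (intro tendsto_intros filterlim_ident assms)
  then have "\<forall>\<^sub>F z in nhds 0. Re (1 - z / \<alpha>) > 0"
    by (rule order_tendstoD) simp
  with eventually_trinomial_nonzero[of \<alpha>] show ?thesis
  proof eventually_elim
    case (elim z)
    have "(\<alpha>\<^sup>2 + exp (- V_log \<alpha> z) - 1) / \<alpha>\<^sup>2 = (1 - z / \<alpha>)\<^sup>2"
      using elim assms by (simp add: V_log_def field_simps power2_eq_square)
    moreover have "csqrt ((1 - z / \<alpha>)\<^sup>2) = 1 - z / \<alpha>"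
      using elim by (intro csqrt_square) simp
    ultimately show ?case
      using assms by (simp add: Z_inv_def sqrt_branch_def field_simps)
  qed
qed

text \<open>Completing the square turns the trinomial at Z(v) into e^(-v), and \<open>Ln\<close>
  undoes this exponential while the imaginary part of v stays below pi in modulus.\<close>

lemma V_log_Z_inv:
  assumes "\<alpha> \<noteq> 0"
  shows "\<forall>\<^sub>F v in nhds 0. V_log \<alpha> (Z_inv \<alpha> v) = v"
proof -
  have "\<forall>\<^sub>F v::complex in nhds 0. v \<in> ball 0 pi"
    by (intro eventually_nhds_in_open) auto
  then show ?thesis
  proof eventually_elim
    case (elim v)
    have "1 - 2 * \<alpha> * Z_inv \<alpha> v + (Z_inv \<alpha> v)\<^sup>2 = (sqrt_branch \<alpha> (\<alpha>\<^sup>2 + exp (- v) - 1))\<^sup>2 - \<alpha>\<^sup>2 + 1"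
      by (simp add: Z_inv_def algebra_simps power2_eq_square)
    also have "\<dots> = exp (- v)"
      using assms by (simp add: sqrt_branch_square)
    finally show ?case
      using elim abs_Im_le_cmod[of v] by (simp add: V_log_def)
  qed
qed

text \<open>The unique existence clauses ensure that the two coefficient formulas are not
  vacuous.\<close>

theorem proposition9p1:
  fixes \<alpha> :: complex
  assumes "\<alpha> \<noteq> 0"
  shows
    "(\<forall>\<^sub>F z in nhds 0. Z_inv \<alpha> (V_log \<alpha> z) = z) \<and>
     (\<forall>\<^sub>F v in nhds 0. V_log \<alpha> (Z_inv \<alpha> v) = v) \<and>
     (\<forall>y. \<forall>\<^sub>F z in nhds 0. exp (y * V_log \<alpha> z) = (1 - 2 * \<alpha> * z + z\<^sup>2) powr (- y)) \<and>
     (\<exists>!p. exp_generated (Z_inv \<alpha>) p) \<and>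
     (\<exists>!q. exp_generated (V_log \<alpha>) q) \<and>
     (\<forall>p. exp_generated (Z_inv \<alpha>) p \<longrightarrow>
        (\<forall>n x. poly (p n) x =
           (\<Sum>k\<le>n. of_nat (Stirling n k) * (- 1) ^ (n - k) * inverse ((2 * \<alpha>\<^sup>2) ^ k)
              * bessel_poly k (\<alpha> * x)))) \<and>
     (\<forall>q. exp_generated (V_log \<alpha>) q \<longrightarrow>
        (\<forall>n x. poly (q n) x = fact n * gegenbauer n x \<alpha>))"
proof -
  have powr: "\<forall>\<^sub>F z in nhds 0. exp (y * V_log \<alpha> z) = (1 - 2 * \<alpha> * z + z\<^sup>2) powr (- y)" for y
    using eventually_trinomial_nonzero[of \<alpha>] by eventually_elim (rule exp_V_log)
  have poly_q: "\<exists>r. \<forall>x. poly r x = fact n * gegenbauer n x \<alpha>" for n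
  proof -
    obtain r where "\<forall>x. poly r x = gegenbauer n x \<alpha>"
      using poly_gegenbauer by blast
    then show ?thesis
      by (intro exI[of _ "smult (fact n) r"]) simp
  qed
  have V_coeff: "fact n * gegenbauer n x \<alpha>
      = fact n * fps_nth (Abs_fps (\<lambda>n. gegenbauer n x \<alpha>)) n" for n x
    by simp
  have Z_coeff: "bessel_stirling \<alpha> n x
      = fact n * fps_nth (Abs_fps (\<lambda>n. bessel_stirling \<alpha> n x / fact n)) n" for n x
    by simp
  note V = exp_generated_unique[OF has_fps_expansion_exp_V_log V_coeff poly_q]
  note Z = exp_generated_unique[OF has_fps_expansion_exp_Z_inv[OF assms] Z_coeff
      poly_bessel_stirling]
  show ?thesis
    unfolding bessel_stirling_def[symmetric]
    by (intro conjI allI impI Z_inv_V_log V_log_Z_inv powr V Z assms)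
qed

end
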